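(* Consider the voting model with $N>2$ worlds and binary signals and the mechanism described in the context. Suppose $T\to\infty$. If all the agents play the truthful strategy, then the mechanism outputs an alternative favored by more than half of the agents.
   Context: Model. $T$ agents ($T$ odd) vote over two alternatives $\mathbf A$ (accept), $\mathbf R$ (reject). The actual world $W\in\{1,\dots,N\}$ is random with $P_n=\Pr(W=n)>0$. Given $W$, agents receive conditionally i.i.d. signals $S_t\in\{\ell,h\}$; with $P_{mn}=\Pr(S_t=m\mid W=n)$, $P_{hn}$ is strictly increasing in $n$. Agent $t$ has a utility function $v_t:\{1,\dots,N\}\times\{\mathbf A,\mathbf R\}\to\{0,\dots,B\}$ ($B$ a positive integer) with $v_t(n,\mathbf A)$ strictly increasing in $n$, $v_t(n,\mathbf R)$ strictly decreasing in $n$, and $v_t(n,\mathbf A)\ne v_t(n,\mathbf R)$ for all $n$. In world $n$, agent $t$ favors the alternative with larger $v_t(n,\cdot)$; $\alpha_n^{\mathbf A}$ is the fraction of agents favoring $\mathbf A$ in world $n$. "Favored" in the claim refers to the actual world. The parameters $B,P_n,P_{mn},\alpha_n^{\mathbf A}$ do not depend on $T$; $P_n$, $P_{mn}$, $\alpha_n^{\mathbf A}$ are common knowledge. Convention for $T\to\infty$. The statement is in the limit $T\to\infty$, where for any world $n$ the fractions of agents receiving signals $\ell$ and $h$ when $n$ is the actual world are, almost surely, $P_{\ell n}$ and $P_{hn}$ respectively. Types. Let $\mathcal L=\{n:\alpha_n^{\mathbf A}<\frac12\}$, $\mathcal H=\{n:\alpha_n^{\mathbf A}>\frac12\}$, a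 partition of the worlds; for each agent let $\mathcal L_t=\{n: v_t(n,\mathbf R)>v_t(n,\mathbf A)\}$, $\mathcal H_t=\{n: v_t(n,\mathbf A)>v_t(n,\mathbf R)\}$. Agent $t$ has type $F$ (candidate-friendly) if $\mathcal H_t\cap\mathcal L\neq\emptyset$, type $U$ (candidate-unfriendly) if $\mathcal L_t\cap\mathcal H\ne\emptyset$, and type $C$ (contingent) if $\mathcal L_t=\mathcal L$. The fractions of the types are $\alpha_F,\alpha_C,\alpha_U$. Let $L=\max\mathcal L$ ($L=0$ if $\mathcal L=\emptyset$) and $H=L+1$, with $P_{h0}=0$ and $P_{h,N+1}=1$. Mechanism. Each agent reports a signal in $\{\ell,h\}$ and a type in $\{F,C,U\}$. If the reported type is $F$, the signal is treated as $h$ and $q_t=0$ is set; if it is $U$, the signal is treated as $\ell$ and $q_t=1$ is set; if it is $C$, the agent additionally reports a value $q_t\in[0,1]$ such that the agent would like $\mathbf A$ if and only if the fraction of agents with (treated) reported signal $h$ is more than $q_t$. Let $\bar q$ be the median of the $q_t$. Output $\mathbf A$ if the fraction of agents with (treated) reported signal $h$ is more than $\bar q$, and $\mathbf R$ otherwise. Truthful strategy. Each agent reports the true type and signal; a contingent agent reports a $q_t$ in the open interval $(\alpha_F+\alpha_CP_{hL},\ \alpha_F+\alpha_CP_{hH})$. *)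

theory Defs
  imports "HOL-Probability.Probability"
begin

datatype alternative = Accept | Reject

datatype signal = Low | High

text \<open>Worlds are the numbers in {1..N}; values of a utility outside that range are irrelevant.\<close>

type_synonym utility = "nat \<Rightarrow> alternative \<Rightarrow> nat"

definition valid_utility :: "nat \<Rightarrow> nat \<Rightarrow> utility \<Rightarrow> bool" where
  "valid_utility N B u \<longleftrightarrow>
     (\<forall>n\<in>{1..N}. \<forall>a. u n a \<le> B) \<and>
     strict_mono_on {1..N} (\<lambda>n. u n Accept) \<and>
     strict_antimono_on {1..N} (\<lambda>n. u n Reject) \<and>
     (\<forall>n\<in>{1..N}. u n Accept \<noteq> u n Reject)"

fun favors :: "utility \<Rightarrow> nat \<Rightarrow> alternative \<Rightarrow> bool" where
  "favors u n Accept \<longleftrightarrow> u n Accept > u n Reject"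
| "favors u n Reject \<longleftrightarrow> u n Reject > u n Accept"

definition agent_fraction :: "nat \<Rightarrow> (nat \<Rightarrow> bool) \<Rightarrow> real" where
  "agent_fraction T Q = real (card {t \<in> {..<T}. Q t}) / real T"

definition majority_favors :: "nat \<Rightarrow> (nat \<Rightarrow> utility) \<Rightarrow> nat \<Rightarrow> alternative \<Rightarrow> bool" where
  "majority_favors T v n a \<longleftrightarrow> agent_fraction T (\<lambda>t. favors (v t) n a) > 1 / 2"

definition low_worlds :: "nat \<Rightarrow> (nat \<Rightarrow> real) \<Rightarrow> nat set" where
  "low_worlds N \<alpha> = {n \<in> {1..N}. \<alpha> n < 1 / 2}"

definition high_worlds :: "nat \<Rightarrow> (nat \<Rightarrow> real) \<Rightarrow> nat set" where
  "high_worlds N \<alpha> = {n \<in> {1..N}. \<alpha> n > 1 / 2}"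

definition agent_low_worlds :: "nat \<Rightarrow> utility \<Rightarrow> nat set" where
  "agent_low_worlds N u = {n \<in> {1..N}. favors u n Reject}"

definition agent_high_worlds :: "nat \<Rightarrow> utility \<Rightarrow> nat set" where
  "agent_high_worlds N u = {n \<in> {1..N}. favors u n Accept}"

definition friendly :: "nat \<Rightarrow> (nat \<Rightarrow> real) \<Rightarrow> utility \<Rightarrow> bool" where
  "friendly N \<alpha> u \<longleftrightarrow> agent_high_worlds N u \<inter> low_worlds N \<alpha> \<noteq> {}"

definition unfriendly :: "nat \<Rightarrow> (nat \<Rightarrow> real) \<Rightarrow> utility \<Rightarrow> bool" where
  "unfriendly N \<alpha> u \<longleftrightarrow> agent_low_worlds N u \<inter> high_worlds N \<alpha> \<noteq> {}"

definition contingent :: "nat \<Rightarrow> (nat \<Rightarrow> real) \<Rightarrow> utility \<Rightarrow> bool" where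
  "contingent N \<alpha> u \<longleftrightarrow> agent_low_worlds N u = low_worlds N \<alpha>"

definition pivot_low :: "nat \<Rightarrow> (nat \<Rightarrow> real) \<Rightarrow> nat" where
  "pivot_low N \<alpha> = (if low_worlds N \<alpha> = {} then 0 else Max (low_worlds N \<alpha>))"

definition pivot_high :: "nat \<Rightarrow> (nat \<Rightarrow> real) \<Rightarrow> nat" where
  "pivot_high N \<alpha> = pivot_low N \<alpha> + 1"

text \<open>The probability of a high signal, extended to the fictitious worlds 0 and N + 1.\<close>

definition high_prob :: "nat \<Rightarrow> (signal \<Rightarrow> nat \<Rightarrow> real) \<Rightarrow> nat \<Rightarrow> real" where
  "high_prob N p n = (if n = 0 then 0 else if n = N + 1 then 1 else p High n)"

datatype report =
  Friendly_Report signal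
| Unfriendly_Report signal
| Contingent_Report signal real

fun treated_signal :: "report \<Rightarrow> signal" where
  "treated_signal (Friendly_Report s) = High"
| "treated_signal (Unfriendly_Report s) = Low"
| "treated_signal (Contingent_Report s q) = s"

fun threshold :: "report \<Rightarrow> real" where
  "threshold (Friendly_Report s) = 0"
| "threshold (Unfriendly_Report s) = 1"
| "threshold (Contingent_Report s q) = q"

text \<open>Applied only to lists of odd length, where the median is the middle entry.\<close>

definition median :: "real list \<Rightarrow> real" where
  "median xs = sort xs ! (length xs div 2)"

definition high_fraction :: "report list \<Rightarrow> real" where
  "high_fraction rs =
     real (length (filter (\<lambda>r. treated_signal r = High) rs)) / real (length rs)"

definition median_threshold :: "report list \<Rightarrow> real" where
  "median_threshold rs = median (map threshold rs)"

text \<open>The decision rule is kept separate from \<open>mechanism\<close>, so that it can also be applied to the limit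
  of the fraction of high reports as the number of agents tends to infinity.\<close>

definition decide :: "real \<Rightarrow> real \<Rightarrow> alternative" where
  "decide x q = (if x > q then Accept else Reject)"

definition mechanism :: "report list \<Rightarrow> alternative" where
  "mechanism rs = decide (high_fraction rs) (median_threshold rs)"

text \<open>The endpoints of the interval from which a truthful contingent agent picks the threshold,
  in an election with \<open>T\<close> agents whose utilities are \<open>v 0, \<dots>, v (T - 1)\<close>.\<close>

definition lower_end ::
    "nat \<Rightarrow> (signal \<Rightarrow> nat \<Rightarrow> real) \<Rightarrow> (nat \<Rightarrow> real) \<Rightarrow> nat \<Rightarrow> (nat \<Rightarrow> utility) \<Rightarrow> real" where
  "lower_end N p \<alpha> T v =
     agent_fraction T (\<lambda>t. friendly N \<alpha> (v t)) +
     agent_fraction T (\<lambda>t. contingent N \<alpha> (v t)) * high_prob N p (pivot_low N \<alpha>)"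

definition upper_end ::
    "nat \<Rightarrow> (signal \<Rightarrow> nat \<Rightarrow> real) \<Rightarrow> (nat \<Rightarrow> real) \<Rightarrow> nat \<Rightarrow> (nat \<Rightarrow> utility) \<Rightarrow> real" where
  "upper_end N p \<alpha> T v =
     agent_fraction T (\<lambda>t. friendly N \<alpha> (v t)) +
     agent_fraction T (\<lambda>t. contingent N \<alpha> (v t)) * high_prob N p (pivot_high N \<alpha>)"

text \<open>\<open>truthful_report N \<alpha> I u s r\<close>: an agent with utility \<open>u\<close> and signal \<open>s\<close> reports the true signal
  and type in \<open>r\<close>, with a threshold in \<open>I\<close> when the type is contingent.\<close>

fun truthful_report ::
    "nat \<Rightarrow> (nat \<Rightarrow> real) \<Rightarrow> real set \<Rightarrow> utility \<Rightarrow> signal \<Rightarrow> report \<Rightarrow> bool" where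
  "truthful_report N \<alpha> I u s (Friendly_Report s') \<longleftrightarrow> s' = s \<and> friendly N \<alpha> u"
| "truthful_report N \<alpha> I u s (Unfriendly_Report s') \<longleftrightarrow> s' = s \<and> unfriendly N \<alpha> u"
| "truthful_report N \<alpha> I u s (Contingent_Report s' q) \<longleftrightarrow> s' = s \<and> contingent N \<alpha> u \<and> q \<in> I"

text \<open>Given \<open>W = n\<close>, the signals of the \<open>T\<close> agents are independent with distribution
  \<open>p _ n\<close>. The measure \<open>uniform_measure M A\<close> is \<open>M\<close> conditioned on the event \<open>A\<close>.\<close>

definition conditionally_iid_signals ::
    "'w measure \<Rightarrow> nat \<Rightarrow> ('w \<Rightarrow> nat) \<Rightarrow> (signal \<Rightarrow> nat \<Rightarrow> real) \<Rightarrow> nat \<Rightarrow> (nat \<Rightarrow> 'w \<Rightarrow> signal) \<Rightarrow> bool"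
  where
  "conditionally_iid_signals M N W p T S \<longleftrightarrow>
     (\<forall>t<T. S t \<in> measurable M (count_space UNIV)) \<and>
     (\<forall>n\<in>{1..N}.
        prob_space.indep_vars (uniform_measure M {\<omega> \<in> space M. W \<omega> = n})
          (\<lambda>_. count_space UNIV) S {..<T} \<and>
        (\<forall>t<T. \<forall>m. \<P>(\<omega> in M. S t \<omega> = m \<bar> W \<omega> = n) = p m n))"

end

(* Utilities are monotone in the world, so every agent rejects exactly on an initial segment of the
   worlds, and so does the majority: the low worlds are {1..L}. Hence a friendly agent is one that
   accepts in world L and an unfriendly agent is one that rejects in world L + 1. Both types are
   strict minorities, and the fractions of all three types are determined by \<alpha>, hence independent
   of the number of agents.

   Since at least half of the thresholds are at most the median and at least half are at least the
   median, a threshold of a non-friendly agent lies weakly below it and one of a non-unfriendly agent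
   weakly above it; so the median lies in the interval of the contingent agents.

   Given W = n, the fraction of high reports tends almost surely to x = aF + aC * P_hn. The signals of
   elections of different sizes need not be independent of each other, so this is a strong law for
   triangular arrays, obtained from Hoeffding's inequality and Borel-Cantelli. Finally x is at or
   below the interval if n \<le> L, and at or above it if n > L. *)

theory Submission
  imports Defs
begin

section \<open>Strong law for triangular arrays of signals\<close>

lemma (in prob_space) AE_row_averages_centered_tendsto_0:
  fixes X :: "nat \<Rightarrow> nat \<Rightarrow> 'a \<Rightarrow> real"
  assumes T: "strict_mono T"
    and indep: "\<And>k. indep_vars (\<lambda>_. borel) (X k) {..<T k}"
    and bounds: "\<And>k t \<omega>. t < T k \<Longrightarrow> \<omega> \<in> space M \<Longrightarrow> X k t \<omega> \<in> {0..1}"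
  shows "AE \<omega> in M. (\<lambda>k. ((\<Sum>t<T k. X k t \<omega>) - (\<Sum>t<T k. expectation (X k t))) / real (T k))
           \<longlonglongrightarrow> 0"
proof -
  define D where
    "D k \<omega> = ((\<Sum>t<T k. X k t \<omega>) - (\<Sum>t<T k. expectation (X k t))) / real (T k)" for k \<omega>
  have X_meas [measurable]: "X k t \<in> borel_measurable M" if "t < T k" for k t
    using indep[of k] that by (auto simp: indep_vars_def)
  have D_meas [measurable]: "D k \<in> borel_measurable M" for k
    unfolding D_def by measurable
  have tail: "prob {\<omega> \<in> space M. \<bar>D k \<omega>\<bar> \<ge> \<epsilon>} \<le> 2 * exp (- 2 * \<epsilon>\<^sup>2) ^ k" if \<epsilon>: "\<epsilon> > 0" for k \<epsilon>
  \<comment> \<open>An empty row has \<open>D k \<omega> = 0\<close>, so the event is empty for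
    \<open>\<epsilon> > 0\<close>.\<close>
  proof (cases "T k = 0")
    case True
    then show ?thesis using \<epsilon> by (simp add: D_def)
  next
    case False
    interpret Hoeffding_ineq M "{..<T k}" "X k" "\<lambda>_. 0" "\<lambda>_. 1"
        "\<Sum>t<T k. expectation (X k t)"
      by unfold_locales (use indep bounds in auto)
    have "{\<omega> \<in> space M. \<bar>D k \<omega>\<bar> \<ge> \<epsilon>} = {\<omega> \<in> space M.
        \<bar>(\<Sum>t<T k. X k t \<omega>) - (\<Sum>t<T k. expectation (X k t))\<bar> \<ge> \<epsilon> * T k}"
      using False by (simp add: D_def field_simps)
    \<comment> \<open>The sum deviates by \<open>\<epsilon> * T k\<close> and the squared ranges add
      up to \<open>T k\<close>, which leaves \<open>T k\<close> in the exponent once.\<close>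
    also have "prob \<dots> \<le> 2 * exp (- 2 * (\<epsilon> * T k)\<^sup>2 / T k)"
      using Hoeffding_ineq_abs_ge[of "\<epsilon> * T k"] \<epsilon> False by simp
    also have "\<dots> = 2 * exp (real (T k) * (- 2 * \<epsilon>\<^sup>2))"
      using False by (simp add: field_simps power2_eq_square)
    \<comment> \<open>A strictly increasing \<open>T\<close> satisfies \<open>k \<le> T k\<close>,
      so the tails are dominated by a geometric series.\<close>
    also have "\<dots> \<le> 2 * exp (real k * (- 2 * \<epsilon>\<^sup>2))"
      using seq_suble[OF T, of k] by (simp add: mult_right_mono)
    finally show ?thesis by (simp only: exp_of_nat_mult)
  qed
  have "AE \<omega> in M. \<forall>\<^sub>F k in sequentially. \<bar>D k \<omega>\<bar> < \<epsilon>" if \<epsilon>: "\<epsilon> > 0" for \<epsilon>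
  proof -
    have "AE \<omega> in M. \<forall>\<^sub>F k in sequentially. \<omega> \<in> space M - {\<omega> \<in> space M. \<bar>D k \<omega>\<bar> \<ge> \<epsilon>}"
    proof (rule borel_cantelli_AE1)
      show "summable (\<lambda>k. prob {\<omega> \<in> space M. \<bar>D k \<omega>\<bar> \<ge> \<epsilon>})"
        by (rule summable_comparison_test'[OF summable_mult[OF summable_geometric]])
          (use tail[OF \<epsilon>] \<epsilon> in auto)
    qed (simp_all add: emeasure_eq_measure)
    then show ?thesis
      by (rule eventually_mono) (auto elim: eventually_mono)
  qed
  \<comment> \<open>The null set depends on \<epsilon>; the countably many values
    \<open>1 / Suc i\<close> yield a single one.\<close>
  then have "AE \<omega> in M. \<forall>i. \<forall>\<^sub>F k in sequentially. \<bar>D k \<omega>\<bar> < 1 / real (Suc i)"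
    by (simp add: AE_all_countable)
  then show ?thesis
  proof (rule eventually_mono)
    fix \<omega>
    assume small: "\<forall>i. \<forall>\<^sub>F k in sequentially. \<bar>D k \<omega>\<bar> < 1 / real (Suc i)"
    have "(\<lambda>k. D k \<omega>) \<longlonglongrightarrow> 0"
    proof (rule tendstoI)
      fix \<epsilon> :: real assume "\<epsilon> > 0"
      then obtain i where "1 / real (Suc i) < \<epsilon>" using nat_approx_posE by blast
      then show "\<forall>\<^sub>F k in sequentially. dist (D k \<omega>) 0 < \<epsilon>"
        using small[rule_format, of i] by (auto elim: eventually_mono)
    qed
    then show "(\<lambda>k. ((\<Sum>t<T k. X k t \<omega>) - (\<Sum>t<T k. expectation (X k t))) / real (T k)) \<longlonglongrightarrow> 0"
      by (simp add: D_def)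
  qed
qed

text \<open>Under \<open>M\<close> conditioned on \<open>W = n\<close> each row of signals is
  independent, so the strong law applies to the indicators of a high signal within the group
  \<open>C k\<close>. The group is deterministic and has the same fraction \<open>c\<close> in every
  row, so every row has the mean \<open>c * p High n\<close>.\<close>

lemma AE_agent_fraction_High_tendsto:
  fixes M :: "'w measure"
  assumes M: "prob_space M"
    and W: "W \<in> measurable M (count_space {1..N})"
    and n: "n \<in> {1..N}" "\<P>(\<omega> in M. W \<omega> = n) > 0"
    and T: "strict_mono T"
    and iid: "\<And>k. conditionally_iid_signals M N W p (T k) (S k)"
    and frac: "\<And>k. agent_fraction (T k) (C k) = c"
  shows "AE \<omega> in M. W \<omega> = n \<longrightarrow>
     (\<lambda>k. agent_fraction (T k) (\<lambda>t. C k t \<and> S k t \<omega> = High)) \<longlonglongrightarrow> c * p High n"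
proof -
  interpret prob_space M by fact
  let ?A = "{\<omega> \<in> space M. W \<omega> = n}"
  let ?U = "uniform_measure M ?A"
  define X :: "nat \<Rightarrow> nat \<Rightarrow> 'w \<Rightarrow> real"
    where "X k t \<omega> = of_bool (C k t \<and> S k t \<omega> = High)" for k t \<omega>
  have W_meas [measurable]: "Measurable.pred M (\<lambda>\<omega>. W \<omega> = n)"
    using measurable_compose[OF W, of "\<lambda>i. i = n" "count_space UNIV"] by simp
  have A: "emeasure M ?A \<noteq> 0" "emeasure M ?A \<noteq> \<infinity>" "emeasure M ?A < \<infinity>"
    using n(2) by (auto simp: emeasure_eq_measure)
  interpret U: prob_space ?U by (rule prob_space_uniform_measure[OF A(1,2)])
  have S_meas: "S k t \<in> measurable M (count_space UNIV)" if "t < T k" for k t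
    using iid[of k] that by (simp add: conditionally_iid_signals_def)
  have expectation_X: "U.expectation (X k t) = of_bool (C k t) * p High n" if t: "t < T k" for k t
  proof -
    note [measurable] = S_meas[OF t]
    have "U.expectation (X k t) =
        U.expectation (\<lambda>\<omega>. of_bool (C k t) * indicator {\<omega> \<in> space M. S k t \<omega> = High} \<omega>)"
      by (intro Bochner_Integration.integral_cong) (auto simp: X_def indicator_def)
    also have "\<dots> = of_bool (C k t) * \<P>(\<omega> in ?U. S k t \<omega> = High)"
      by simp
    also have "\<P>(\<omega> in ?U. S k t \<omega> = High) = \<P>(\<omega> in M. S k t \<omega> = High \<bar> W \<omega> = n)"
      by (intro measure_uniform_measure_eq_cond_prob) measurable
    also have "\<dots> = p High n"
      using iid[of k] n(1) t by (simp add: conditionally_iid_signals_def)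
    finally show ?thesis .
  qed
  have "AE \<omega> in ?U. (\<lambda>k. ((\<Sum>t<T k. X k t \<omega>) - (\<Sum>t<T k. U.expectation (X k t))) / real (T k)) \<longlonglongrightarrow> 0"
  proof (rule U.AE_row_averages_centered_tendsto_0[OF T])
    fix k
    have "U.indep_vars (\<lambda>_. count_space UNIV) (S k) {..<T k}"
      using iid[of k] n(1) by (simp add: conditionally_iid_signals_def)
    then show "U.indep_vars (\<lambda>_. borel) (X k) {..<T k}"
      unfolding X_def
      by (rule U.indep_vars_compose2[where Y = "\<lambda>t s. of_bool (C k t \<and> s = High)"]) simp
  qed (simp add: X_def)
  moreover have "((\<Sum>t<T k. X k t \<omega>) - (\<Sum>t<T k. U.expectation (X k t))) / real (T k)
      = agent_fraction (T k) (\<lambda>t. C k t \<and> S k t \<omega> = High) - c * p High n" for k \<omega>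
  proof -
    have count: "(\<Sum>t<T k. of_bool (Q t)) / real (T k) = agent_fraction (T k) Q" for Q
      by (simp add: agent_fraction_def Int_def)
    have "(\<Sum>t<T k. U.expectation (X k t)) = (\<Sum>t<T k. of_bool (C k t)) * p High n"
      by (simp add: expectation_X sum_distrib_right)
    then show ?thesis
      using count[of "C k"] count[of "\<lambda>t. C k t \<and> S k t \<omega> = High"]
      by (simp add: X_def diff_divide_distrib frac flip: times_divide_eq_left)
  qed
  ultimately have "AE \<omega> in ?U.
      (\<lambda>k. agent_fraction (T k) (\<lambda>t. C k t \<and> S k t \<omega> = High) - c * p High n) \<longlonglongrightarrow> 0"
    by simp
  then have "AE \<omega> in ?U. (\<lambda>k. agent_fraction (T k) (\<lambda>t. C k t \<and> S k t \<omega> = High)) \<longlonglongrightarrow> c * p High n"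
    by (rule eventually_mono) (simp add: LIM_zero_iff)
  then have "AE \<omega> in M. \<omega> \<in> ?A \<longrightarrow>
      (\<lambda>k. agent_fraction (T k) (\<lambda>t. C k t \<and> S k t \<omega> = High)) \<longlonglongrightarrow> c * p High n"
    by (simp only: AE_uniform_measure[OF A(1,3)])
  then show ?thesis by (rule AE_mp) auto
qed

text \<open>Non-measurable sets have measure 0 and division by 0 gives 0, so the bounds hold for
  arbitrary predicates. They confine \<open>p High n\<close>, which is given only as a conditional
  probability, to the unit interval.\<close>

lemma (in prob_space) cond_prob_bounds: "cond_prob M P Q \<in> {0..1}"
proof (cases "prob {\<omega> \<in> space M. Q \<omega>} = 0")
  case False
  then have "{\<omega> \<in> space M. Q \<omega>} \<in> events" using measure_notin_sets by blast
  then have "prob {\<omega> \<in> space M. P \<omega> \<and> Q \<omega>} \<le> prob {\<omega> \<in> space M. Q \<omega>}"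
    by (intro finite_measure_mono) auto
  then show ?thesis by (simp add: cond_prob_def divide_le_eq_1 less_le)
qed (simp add: cond_prob_def)

section \<open>Fractions of agents and the median\<close>

lemma agent_fraction_nonneg: "0 \<le> agent_fraction T Q"
  by (simp add: agent_fraction_def)

lemma agent_fraction_cong:
  "(\<And>t. t < T \<Longrightarrow> Q t \<longleftrightarrow> R t) \<Longrightarrow> agent_fraction T Q = agent_fraction T R"
  unfolding agent_fraction_def by (metis (no_types, lifting) Collect_cong lessThan_iff)

lemma agent_fraction_mono:
  "(\<And>t. t < T \<Longrightarrow> Q t \<Longrightarrow> R t) \<Longrightarrow> agent_fraction T Q \<le> agent_fraction T R"
  unfolding agent_fraction_def by (intro divide_right_mono of_nat_mono card_mono) auto

lemma agent_fraction_disj: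
  assumes "\<And>t. t < T \<Longrightarrow> \<not> (Q t \<and> R t)"
  shows "agent_fraction T (\<lambda>t. Q t \<or> R t) = agent_fraction T Q + agent_fraction T R"
proof -
  have "{t \<in> {..<T}. Q t \<or> R t} = {t \<in> {..<T}. Q t} \<union> {t \<in> {..<T}. R t}" by auto
  moreover have "{t \<in> {..<T}. Q t} \<inter> {t \<in> {..<T}. R t} = {}" using assms by auto
  ultimately show ?thesis
    by (simp add: agent_fraction_def card_Un_disjoint add_divide_distrib)
qed

lemma agent_fraction_not:
  assumes "T > 0"
  shows "agent_fraction T (\<lambda>t. \<not> Q t) = 1 - agent_fraction T Q"
proof -
  have "agent_fraction T (\<lambda>t. Q t \<or> \<not> Q t) = 1"
    using assms by (simp add: agent_fraction_def)
  then show ?thesis using agent_fraction_disj[of T Q "\<lambda>t. \<not> Q t"] by simp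
qed

text \<open>A tie would make \<open>T\<close> twice a cardinality.\<close>

lemma agent_fraction_ne_half: "odd T \<Longrightarrow> agent_fraction T Q \<noteq> 1 / 2"
proof
  assume "odd T" "agent_fraction T Q = 1 / 2"
  then have "real (2 * card {t \<in> {..<T}. Q t}) = real T"
    by (auto simp: agent_fraction_def field_simps odd_pos)
  then show False using \<open>odd T\<close> by (metis even_mult_iff even_numeral of_nat_eq_iff)
qed

lemma agent_fraction_map:
  "real (length (filter Q (map f [0..<T]))) / real T = agent_fraction T (\<lambda>t. Q (f t))"
  unfolding agent_fraction_def length_filter_conv_card
  by (auto intro!: arg_cong[where f = card])

text \<open>In the sorted list the positions up to \<open>T div 2\<close> carry values at most the
  median, and those from \<open>T div 2\<close> on values at least the median. Both ranges contain
  the middle position, so neither has fewer than \<open>T / 2\<close> elements.\<close>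

lemma agent_fraction_le_median:
  assumes "T > 0"
  shows "agent_fraction T (\<lambda>t. q t \<le> median (map q [0..<T])) \<ge> 1 / 2"
    and "agent_fraction T (\<lambda>t. q t \<ge> median (map q [0..<T])) \<ge> 1 / 2"
proof -
  define ys m where "ys = sort (map q [0..<T])" and "m = median (map q [0..<T])"
  have ys: "length ys = T" "sorted ys" and m: "m = ys ! (T div 2)"
    by (simp_all add: ys_def m_def median_def)
  \<comment> \<open>Sorting only permutes the values, so agents may be counted by positions in
    \<open>ys\<close>.\<close>
  have count: "agent_fraction T (\<lambda>t. Q (q t)) = real (card {i. i < T \<and> Q (ys ! i)}) / real T" for Q
  proof -
    have "length (filter Q (map q [0..<T])) = length (filter Q ys)"
      unfolding ys_def by (metis length_sort filter_sort)
    then show ?thesis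
      using ys by (simp add: length_filter_conv_card flip: agent_fraction_map)
  qed
  have "{..T div 2} \<subseteq> {i. i < T \<and> ys ! i \<le> m}"
    using assms ys m div_less_dividend[of 2 T] by (auto simp: sorted_nth_mono simp del: div_less_dividend)
  then have "card {..T div 2} \<le> card {i. i < T \<and> ys ! i \<le> m}"
    by (rule card_mono[rotated]) simp
  then have "real T \<le> 2 * real (card {i. i < T \<and> ys ! i \<le> m})" by simp
  then show "agent_fraction T (\<lambda>t. q t \<le> median (map q [0..<T])) \<ge> 1 / 2"
    using assms unfolding m_def[symmetric] count[of "\<lambda>x. x \<le> m"] by (simp add: field_simps)
  have "{T div 2..<T} \<subseteq> {i. i < T \<and> ys ! i \<ge> m}"
    using ys m by (auto simp: sorted_nth_mono)
  then have "card {T div 2..<T} \<le> card {i. i < T \<and> ys ! i \<ge> m}"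
    by (rule card_mono[rotated]) simp
  then have "real T \<le> 2 * real (card {i. i < T \<and> ys ! i \<ge> m})" by simp
  then show "agent_fraction T (\<lambda>t. q t \<ge> median (map q [0..<T])) \<ge> 1 / 2"
    using assms unfolding m_def[symmetric] count[of "\<lambda>x. x \<ge> m"] by (simp add: field_simps)
qed

text \<open>A strict minority cannot contain half of the agents. This supplies the agents on either
  side of the median.\<close>

lemma agent_fraction_overlap:
  assumes "agent_fraction T Q \<ge> 1 / 2" "agent_fraction T R < 1 / 2"
  obtains t where "t < T" "Q t" "\<not> R t"
proof -
  have "\<not> (\<forall>t<T. Q t \<longrightarrow> R t)"
    using agent_fraction_mono[of T Q R] assms by auto
  then show ?thesis using that by blast
qed

section \<open>Monotone preferences of one agent\<close>

lemma favors_Reject_iff: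
  assumes "valid_utility N B u" "n \<in> {1..N}"
  shows "favors u n Reject \<longleftrightarrow> \<not> favors u n Accept"
proof -
  have "u n Accept \<noteq> u n Reject" using assms unfolding valid_utility_def by blast
  then show ?thesis by auto
qed

lemma favors_Accept_mono:
  assumes "valid_utility N B u" "m \<in> {1..N}" "n \<in> {1..N}" "m \<le> n" "favors u m Accept"
  shows "favors u n Accept"
proof (cases "m = n")
  case False
  then have "m < n" using assms by simp
  moreover have "strict_mono_on {1..N} (\<lambda>n. u n Accept)" "strict_antimono_on {1..N} (\<lambda>n. u n Reject)"
    using assms by (simp_all add: valid_utility_def)
  ultimately have "u m Accept < u n Accept" "u n Reject < u m Reject"
    using assms(2,3) by (blast dest: monotone_onD)+
  then show ?thesis using assms(5) by simp
qed (use assms in simp)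

section \<open>Types, median and decision in one election\<close>

text \<open>A single election of fixed size; the limit theorem instantiates it for every
  \<open>k\<close> with the same \<open>N\<close>, \<open>B\<close> and \<alpha>.\<close>

locale election =
  fixes N B :: nat and \<alpha> :: "nat \<Rightarrow> real" and T :: nat and v :: "nat \<Rightarrow> utility"
  assumes odd_T: "odd T"
    and valid: "\<And>t. t < T \<Longrightarrow> valid_utility N B (v t)"
    and \<alpha>: "\<And>n. n \<in> {1..N} \<Longrightarrow> agent_fraction T (\<lambda>t. favors (v t) n Accept) = \<alpha> n"
begin

abbreviation L where "L \<equiv> pivot_low N \<alpha>"

lemma T_pos: "T > 0"
  using odd_T by (rule odd_pos)

lemma \<alpha>_mono: "m \<in> {1..N} \<Longrightarrow> n \<in> {1..N} \<Longrightarrow> m \<le> n \<Longrightarrow> \<alpha> m \<le> \<alpha> n"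
  by (metis (no_types, lifting) \<alpha> agent_fraction_mono favors_Accept_mono valid)

lemma \<alpha>_ne_half: "n \<in> {1..N} \<Longrightarrow> \<alpha> n \<noteq> 1 / 2"
  by (metis \<alpha> agent_fraction_ne_half odd_T)

text \<open>Monotonicity of \<alpha> makes the low worlds downward closed, with maximum
  \<open>L\<close>. If there are none, the default \<open>L = 0\<close> gives the empty range
  \<open>{1..0}\<close>.\<close>

lemma low_worlds_eq: "low_worlds N \<alpha> = {1..L}" and L_le: "L \<le> N"
proof -
  have fin: "finite (low_worlds N \<alpha>)" by (simp add: low_worlds_def)
  show "L \<le> N"
    using Max_in[OF fin] by (auto simp: pivot_low_def low_worlds_def)
  show "low_worlds N \<alpha> = {1..L}"
  proof (cases "low_worlds N \<alpha> = {}")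
    case False
    then have L: "L \<in> low_worlds N \<alpha>" and "\<And>n. n \<in> low_worlds N \<alpha> \<Longrightarrow> n \<le> L"
      using Max_in[OF fin] Max_ge[OF fin] by (simp_all add: pivot_low_def)
    moreover have "n \<in> low_worlds N \<alpha>" if "n \<in> {1..L}" for n
      using that L \<alpha>_mono[of n L] by (auto simp: low_worlds_def)
    ultimately show ?thesis by (fastforce simp: low_worlds_def)
  qed (simp add: pivot_low_def)
qed

lemma \<alpha>_low: "n \<in> {1..N} \<Longrightarrow> \<alpha> n < 1 / 2 \<longleftrightarrow> n \<le> L"
  using low_worlds_eq by (auto simp: low_worlds_def set_eq_iff)

text \<open>Ties being excluded, the high worlds are the complement of the low ones.\<close>

lemma high_worlds_eq: "high_worlds N \<alpha> = {L+1..N}"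
proof (rule set_eqI)
  fix n
  show "n \<in> high_worlds N \<alpha> \<longleftrightarrow> n \<in> {L+1..N}"
    using \<alpha>_low[of n] \<alpha>_ne_half[of n] by (cases "n \<in> {1..N}") (auto simp: high_worlds_def)
qed

text \<open>Acceptance passes to higher worlds, so the highest low world \<open>L\<close> decides.
  The conjunct \<open>L > 0\<close> covers the case without low worlds, where \<open>L\<close> is no
  actual world.\<close>

lemma friendly_iff:
  assumes "t < T"
  shows "friendly N \<alpha> (v t) \<longleftrightarrow> L > 0 \<and> favors (v t) L Accept"
proof -
  have "friendly N \<alpha> (v t) \<longleftrightarrow> (\<exists>n\<in>{1..L}. favors (v t) n Accept)"
    using L_le by (fastforce simp: friendly_def low_worlds_eq agent_high_worlds_def simp del: favors.simps)
  also have "\<dots> \<longleftrightarrow> L > 0 \<and> favors (v t) L Accept"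
  proof (intro iffI conjI)
    assume "\<exists>n\<in>{1..L}. favors (v t) n Accept"
    then obtain n where n: "n \<in> {1..L}" "favors (v t) n Accept" ..
    then show "favors (v t) L Accept"
      using favors_Accept_mono[OF valid[OF assms], of n L] L_le by auto
    show "L > 0" using n by simp
  qed (auto simp del: favors.simps intro: bexI[of _ L])
  finally show ?thesis .
qed

text \<open>Dually, rejection passes to lower worlds and \<open>L + 1\<close> is the lowest high
  world, provided that \<open>L < N\<close>.\<close>

lemma unfriendly_iff:
  assumes "t < T"
  shows "unfriendly N \<alpha> (v t) \<longleftrightarrow> L < N \<and> \<not> favors (v t) (L + 1) Accept"
proof -
  have "agent_low_worlds N (v t) \<inter> {L+1..N} = {n \<in> {L+1..N}. \<not> favors (v t) n Accept}"
    using favors_Reject_iff[OF valid[OF assms]]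
    by (auto simp: agent_low_worlds_def simp del: favors.simps)
  then have "unfriendly N \<alpha> (v t) \<longleftrightarrow> (\<exists>n\<in>{L+1..N}. \<not> favors (v t) n Accept)"
    unfolding unfriendly_def high_worlds_eq by (simp only:) blast
  also have "\<dots> \<longleftrightarrow> L < N \<and> \<not> favors (v t) (L + 1) Accept"
  proof (intro iffI conjI)
    assume "\<exists>n\<in>{L+1..N}. \<not> favors (v t) n Accept"
    then obtain n where n: "n \<in> {L+1..N}" "\<not> favors (v t) n Accept" ..
    then show "\<not> favors (v t) (L + 1) Accept"
      using favors_Accept_mono[OF valid[OF assms], of "L + 1" n] by auto
    show "L < N" using n by simp
  qed (auto simp del: favors.simps intro: bexI[of _ "L + 1"])
  finally show ?thesis .
qed

text \<open>Equality of the two sets of worlds is a pair of inclusions: the failure of one is being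
  friendly, the failure of the other is being unfriendly.\<close>

lemma contingent_iff:
  assumes "t < T"
  shows "contingent N \<alpha> (v t) \<longleftrightarrow> \<not> friendly N \<alpha> (v t) \<and> \<not> unfriendly N \<alpha> (v t)"
proof -
  have "friendly N \<alpha> (v t) \<longleftrightarrow> \<not> low_worlds N \<alpha> \<subseteq> agent_low_worlds N (v t)"
    using favors_Reject_iff[OF valid[OF assms]]
    by (auto simp: friendly_def agent_low_worlds_def agent_high_worlds_def low_worlds_def simp del: favors.simps)
  moreover have "high_worlds N \<alpha> = {1..N} - low_worlds N \<alpha>"
    using L_le by (auto simp: high_worlds_eq low_worlds_eq)
  then have "unfriendly N \<alpha> (v t) \<longleftrightarrow> \<not> agent_low_worlds N (v t) \<subseteq> low_worlds N \<alpha>"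
    by (auto simp: unfriendly_def agent_low_worlds_def)
  ultimately show ?thesis
    by (auto simp: contingent_def)
qed

text \<open>Such an agent would accept in world \<open>L\<close> but reject in world
  \<open>L + 1\<close>.\<close>

lemma not_friendly_and_unfriendly:
  assumes "t < T"
  shows "\<not> (friendly N \<alpha> (v t) \<and> unfriendly N \<alpha> (v t))"
proof
  assume "friendly N \<alpha> (v t) \<and> unfriendly N \<alpha> (v t)"
  then have "0 < L" "L < N" "favors (v t) L Accept" "\<not> favors (v t) (L + 1) Accept"
    using friendly_iff[OF assms] unfriendly_iff[OF assms] by blast+
  then show False
    using favors_Accept_mono[OF valid[OF assms], of L "L + 1"] by simp
qed

lemma agent_fraction_favors_Reject:
  assumes "n \<in> {1..N}"
  shows "agent_fraction T (\<lambda>t. \<not> favors (v t) n Accept) = 1 - \<alpha> n"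
    and "agent_fraction T (\<lambda>t. favors (v t) n Reject) = 1 - \<alpha> n"
proof -
  show "agent_fraction T (\<lambda>t. \<not> favors (v t) n Accept) = 1 - \<alpha> n"
    by (simp only: agent_fraction_not[OF T_pos] \<alpha>[OF assms])
  then show "agent_fraction T (\<lambda>t. favors (v t) n Reject) = 1 - \<alpha> n"
    using agent_fraction_cong[of T "\<lambda>t. favors (v t) n Reject" "\<lambda>t. \<not> favors (v t) n Accept"]
      favors_Reject_iff[OF valid assms] by metis
qed

lemma friendly_fraction:
  "agent_fraction T (\<lambda>t. friendly N \<alpha> (v t)) = (if L = 0 then 0 else \<alpha> L)"
proof -
  have "agent_fraction T (\<lambda>t. friendly N \<alpha> (v t)) =
      agent_fraction T (\<lambda>t. L > 0 \<and> favors (v t) L Accept)"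
    by (rule agent_fraction_cong) (rule friendly_iff)
  also have "\<dots> = (if L = 0 then 0 else \<alpha> L)"
    using \<alpha>[of L] L_le by (cases "L = 0") (simp_all add: agent_fraction_def)
  finally show ?thesis .
qed

lemma unfriendly_fraction:
  "agent_fraction T (\<lambda>t. unfriendly N \<alpha> (v t)) = (if L = N then 0 else 1 - \<alpha> (L + 1))"
proof -
  have "agent_fraction T (\<lambda>t. unfriendly N \<alpha> (v t)) =
      agent_fraction T (\<lambda>t. L < N \<and> \<not> favors (v t) (L + 1) Accept)"
    by (rule agent_fraction_cong) (rule unfriendly_iff)
  also have "\<dots> = (if L = N then 0 else 1 - \<alpha> (L + 1))"
  proof (cases "L = N")
    case False
    then have "L < N" "L + 1 \<in> {1..N}" using L_le by auto
    then show ?thesis using agent_fraction_favors_Reject(1)[of "L + 1"] by (simp del: favors.simps)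
  qed (simp add: agent_fraction_def)
  finally show ?thesis .
qed

text \<open>If \<open>L > 0\<close>, the friendly agents are those accepting in the low world
  \<open>L\<close>.\<close>

lemma friendly_minority: "agent_fraction T (\<lambda>t. friendly N \<alpha> (v t)) < 1 / 2"
  using \<alpha>_low[of L] L_le by (simp add: friendly_fraction)

text \<open>If \<open>L < N\<close>, the unfriendly agents are those rejecting in the high world
  \<open>L + 1\<close>, where acceptance has a strict majority.\<close>

lemma unfriendly_minority: "agent_fraction T (\<lambda>t. unfriendly N \<alpha> (v t)) < 1 / 2"
proof (cases "L = N")
  case False
  then have L: "L + 1 \<in> {1..N}" using L_le by simp
  show ?thesis
    using False \<alpha>_low[OF L] \<alpha>_ne_half[OF L] unfolding unfriendly_fraction by simp
qed (simp add: unfriendly_fraction)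

lemma type_fractions_sum:
  "agent_fraction T (\<lambda>t. friendly N \<alpha> (v t)) + agent_fraction T (\<lambda>t. unfriendly N \<alpha> (v t)) +
     agent_fraction T (\<lambda>t. contingent N \<alpha> (v t)) = 1"
proof -
  have "agent_fraction T (\<lambda>t. contingent N \<alpha> (v t)) =
      agent_fraction T (\<lambda>t. \<not> (friendly N \<alpha> (v t) \<or> unfriendly N \<alpha> (v t)))"
    by (rule agent_fraction_cong) (simp add: contingent_iff)
  also have "\<dots> = 1 - (agent_fraction T (\<lambda>t. friendly N \<alpha> (v t)) + agent_fraction T (\<lambda>t. unfriendly N \<alpha> (v t)))"
    using not_friendly_and_unfriendly by (subst agent_fraction_not[OF T_pos], subst agent_fraction_disj) auto
  finally show ?thesis by simp
qed

text \<open>A general interval \<open>I\<close> serves both the open interval of truthful thresholds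
  and the closed one shrunk by a margin.\<close>

lemma median_threshold_in_interval:
  assumes truthful: "\<And>t. t < T \<Longrightarrow> truthful_report N \<alpha> I (v t) (s t) (R t)"
    and I: "is_interval I" "I \<subseteq> {0..1}"
  shows "median_threshold (map R [0..<T]) \<in> I"
proof -
  let ?q = "\<lambda>t. threshold (R t)"
  let ?m = "median (map ?q [0..<T])"
  obtain t where t: "t < T" "?q t \<le> ?m" "\<not> friendly N \<alpha> (v t)"
    using agent_fraction_overlap[OF agent_fraction_le_median(1)[OF T_pos] friendly_minority] .
  obtain t' where t': "t' < T" "?q t' \<ge> ?m" "\<not> unfriendly N \<alpha> (v t')"
    using agent_fraction_overlap[OF agent_fraction_le_median(2)[OF T_pos] unfriendly_minority] .
  have "?q t \<in> I \<or> ?q t = 1"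
    using truthful[OF t(1)] t(3) by (cases "R t") auto
  moreover have "?q t' \<in> I \<or> ?q t' = 0"
    using truthful[OF t'(1)] t'(3) by (cases "R t'") auto
  \<comment> \<open>If both thresholds lie in \<open>I\<close>, so does the median between them. If
    \<open>?q t = 1\<close>, then \<open>?q t'\<close> is at least 1, hence lies in \<open>I\<close>
    and equals 1, which is then the median; the case \<open>?q t' = 0\<close> is symmetric.\<close>
  ultimately have "?m \<in> I"
    using t(2) t'(2) I unfolding is_interval_1 by (smt (verit) atLeastAtMost_iff subsetD)
  then show ?thesis by (simp add: median_threshold_def comp_def)
qed

text \<open>Friendly agents count as high and unfriendly ones as low whatever their signals; only
  contingent agents contribute randomness.\<close>

lemma high_fraction_truthful:
  assumes "\<And>t. t < T \<Longrightarrow> truthful_report N \<alpha> I (v t) (s t) (R t)"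
  shows "high_fraction (map R [0..<T]) =
    agent_fraction T (\<lambda>t. friendly N \<alpha> (v t)) +
    agent_fraction T (\<lambda>t. contingent N \<alpha> (v t) \<and> s t = High)"
proof -
  have "high_fraction (map R [0..<T]) = agent_fraction T (\<lambda>t. treated_signal (R t) = High)"
    using agent_fraction_map[of "\<lambda>r. treated_signal r = High" R T]
    by (simp only: high_fraction_def length_map length_upt diff_zero)
  also have "\<dots> = agent_fraction T (\<lambda>t. friendly N \<alpha> (v t) \<or> contingent N \<alpha> (v t) \<and> s t = High)"
  proof (rule agent_fraction_cong)
    fix t assume "t < T"
    then show "treated_signal (R t) = High \<longleftrightarrow>
        friendly N \<alpha> (v t) \<or> contingent N \<alpha> (v t) \<and> s t = High"
      using assms[of t] not_friendly_and_unfriendly[of t] contingent_iff[of t] by (cases "R t") auto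
  qed
  also have "\<dots> = agent_fraction T (\<lambda>t. friendly N \<alpha> (v t)) +
      agent_fraction T (\<lambda>t. contingent N \<alpha> (v t) \<and> s t = High)"
    by (rule agent_fraction_disj) (simp add: contingent_iff)
  finally show ?thesis .
qed

text \<open>The weak and the strict inequality reflect that \<open>decide\<close> resolves equality
  as \<open>Reject\<close>. The number \<open>x\<close> is arbitrary so that it can be the limit
  fraction or the fraction in a finite election.\<close>

lemma majority_favors_decide:
  assumes n: "n \<in> {1..N}" and "n \<le> L \<Longrightarrow> x \<le> q" and "n > L \<Longrightarrow> x > q"
  shows "majority_favors T v n (decide x q)"
proof (cases "n \<le> L")
  case True
  then show ?thesis
    using assms \<alpha>_low[OF n] agent_fraction_favors_Reject(2)[OF n]
    by (simp add: majority_favors_def decide_def del: favors.simps)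
next
  case False
  then show ?thesis
    using assms \<alpha>[OF n] \<alpha>_low[OF n] \<alpha>_ne_half[OF n]
    by (simp add: majority_favors_def decide_def del: favors.simps)
qed

end

section \<open>Almost sure decisions as the number of agents grows\<close>

text \<open>The first conjunct takes the claim in the limit, with the limit fraction
  \<open>x\<close> compared to the median. The second concerns the mechanism on finitely many
  reports: thresholds may approach the ends of the open interval as \<open>k\<close> grows, so a
  margin \<delta> independent of \<open>k\<close> is imposed to absorb the sampling error.\<close>

theorem theoremB3:
  fixes M :: "'w measure"
    and N B :: nat
    and W :: "'w \<Rightarrow> nat"
    and P :: "nat \<Rightarrow> real"
    and p :: "signal \<Rightarrow> nat \<Rightarrow> real"
    and \<alpha> :: "nat \<Rightarrow> real"
    and T :: "nat \<Rightarrow> nat"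
    and v :: "nat \<Rightarrow> nat \<Rightarrow> utility"
    and S :: "nat \<Rightarrow> nat \<Rightarrow> 'w \<Rightarrow> signal"
    and r :: "nat \<Rightarrow> nat \<Rightarrow> 'w \<Rightarrow> report"
  defines "reports \<equiv> \<lambda>k \<omega>. map (\<lambda>t. r k t \<omega>) [0..<T k]"
    and "lo \<equiv> \<lambda>k. lower_end N p \<alpha> (T k) (v k)"
    and "hi \<equiv> \<lambda>k. upper_end N p \<alpha> (T k) (v k)"
  assumes "prob_space M"
    and "N > 2" and "B > 0"
    and "W \<in> measurable M (count_space {1..N})"
    and "\<And>n. n \<in> {1..N} \<Longrightarrow> \<P>(\<omega> in M. W \<omega> = n) = P n \<and> P n > 0"
    and "strict_mono_on {1..N} (p High)"
    and "strict_mono T" and "\<And>k. odd (T k)"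
    and "\<And>k t. t < T k \<Longrightarrow> valid_utility N B (v k t)"
    and "\<And>k n. n \<in> {1..N} \<Longrightarrow> agent_fraction (T k) (\<lambda>t. favors (v k t) n Accept) = \<alpha> n"
    and "\<And>k. conditionally_iid_signals M N W p (T k) (S k)"
    and truthful: "\<And>k t \<omega>. t < T k \<Longrightarrow> \<omega> \<in> space M \<Longrightarrow>
           truthful_report N \<alpha> {lo k<..<hi k} (v k t) (S k t \<omega>) (r k t \<omega>)"
  shows "AE \<omega> in M.
           (\<exists>x. (\<lambda>k. high_fraction (reports k \<omega>)) \<longlonglongrightarrow> x \<and>
                (\<forall>k. majority_favors (T k) (v k) (W \<omega>)
                        (decide x (median_threshold (reports k \<omega>))))) \<and>
           (\<forall>\<delta>>0. \<forall>\<^sub>F k in sequentially.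
                (\<forall>t<T k. truthful_report N \<alpha> {lo k + \<delta>..hi k - \<delta>} (v k t) (S k t \<omega>) (r k t \<omega>)) \<longrightarrow>
                majority_favors (T k) (v k) (W \<omega>) (mechanism (reports k \<omega>)))"
proof -
  interpret prob_space M by fact
  define L where "L = pivot_low N \<alpha>"
  \<comment> \<open>Election 0 serves as representative; \<open>F\<close>, \<open>U\<close> and
    \<open>C\<close> below show that all elections share its type fractions.\<close>
  define aF where "aF = agent_fraction (T 0) (\<lambda>t. friendly N \<alpha> (v 0 t))"
  define aU where "aU = agent_fraction (T 0) (\<lambda>t. unfriendly N \<alpha> (v 0 t))"
  define aC where "aC = agent_fraction (T 0) (\<lambda>t. contingent N \<alpha> (v 0 t))"
  have election: "election N B \<alpha> (T k) (v k)" for k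
    by unfold_locales (use assms in auto)
  have F: "agent_fraction (T k) (\<lambda>t. friendly N \<alpha> (v k t)) = aF" for k
    by (simp add: aF_def election.friendly_fraction[OF election])
  have U: "agent_fraction (T k) (\<lambda>t. unfriendly N \<alpha> (v k t)) = aU" for k
    by (simp add: aU_def election.unfriendly_fraction[OF election])
  have C: "agent_fraction (T k) (\<lambda>t. contingent N \<alpha> (v k t)) = aC" for k
    using election.type_fractions_sum[OF election, of k] election.type_fractions_sum[OF election, of 0]
    unfolding aC_def F U by linarith
  have a_bounds: "0 \<le> aF" "0 \<le> aC" "aF + aC \<le> 1"
    using election.type_fractions_sum[OF election, of 0]
      agent_fraction_nonneg[of "T 0" "\<lambda>t. friendly N \<alpha> (v 0 t)"]
      agent_fraction_nonneg[of "T 0" "\<lambda>t. unfriendly N \<alpha> (v 0 t)"]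
      agent_fraction_nonneg[of "T 0" "\<lambda>t. contingent N \<alpha> (v 0 t)"]
    unfolding aF_def aC_def by linarith+
  have p_bounds: "p High n \<in> {0..1}" if "n \<in> {1..N}" for n
  proof -
    \<comment> \<open>Agent 0 of election 0 exists because \<open>T 0\<close> is odd, hence
      positive.\<close>
    have "p High n = \<P>(\<omega> in M. S 0 0 \<omega> = High \<bar> W \<omega> = n)"
      using assms(14)[of 0] assms(11)[of 0] that
      by (simp add: conditionally_iid_signals_def odd_pos)
    then show ?thesis using cond_prob_bounds by simp
  qed
  have L_le: "L \<le> N"
    unfolding L_def by (rule election.L_le[OF election])
  define l h where "l = aF + aC * high_prob N p L" and "h = aF + aC * high_prob N p (L + 1)"
  have lo: "lo k = l" and hi: "hi k = h" for k
    by (simp_all add: lo_def hi_def l_def h_def lower_end_def upper_end_def F C pivot_high_def L_def)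
  \<comment> \<open>The conventions 0 at world 0 and 1 at world \<open>N + 1\<close> keep the
    interval inside \<open>{0..1}\<close> when \<open>L = 0\<close> or \<open>L = N\<close>.\<close>
  have "high_prob N p L \<ge> 0" "high_prob N p (L + 1) \<le> 1"
    using p_bounds[of L] p_bounds[of "L + 1"] L_le by (auto simp: high_prob_def)
  then have lh: "0 \<le> l" "h \<le> 1"
    using a_bounds mult_left_mono[of "high_prob N p (L + 1)" 1 aC] by (auto simp: l_def h_def)
  have p_mono: "p High m \<le> p High n" if "m \<in> {1..N}" "n \<in> {1..N}" "m \<le> n" for m n
    using strict_mono_on_leD[OF assms(9)] that by blast

  \<comment> \<open>There are finitely many worlds, each of positive probability, so the null sets
    of the conditional laws combine.\<close>
  have "AE \<omega> in M. \<forall>n\<in>{1..N}. W \<omega> = n \<longrightarrow>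
      (\<lambda>k. agent_fraction (T k) (\<lambda>t. contingent N \<alpha> (v k t) \<and> S k t \<omega> = High)) \<longlonglongrightarrow> aC * p High n"
    by (intro AE_finite_allI AE_agent_fraction_High_tendsto[OF assms(4,7)]) (use assms C in auto)
  then show ?thesis
  proof (rule AE_mp, intro AE_I2 impI)
    fix \<omega>
    assume \<omega>: "\<omega> \<in> space M" and conv: "\<forall>n\<in>{1..N}. W \<omega> = n \<longrightarrow>
      (\<lambda>k. agent_fraction (T k) (\<lambda>t. contingent N \<alpha> (v k t) \<and> S k t \<omega> = High)) \<longlonglongrightarrow> aC * p High n"
    define n where "n = W \<omega>"
    define x where "x = aF + aC * p High n"
    have n: "n \<in> {1..N}"
      using measurable_space[OF assms(7) \<omega>] by (simp add: n_def)
    \<comment> \<open>\<open>n \<le> L\<close> makes \<open>L\<close> an actual world and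
      \<open>n > L\<close> makes \<open>L + 1\<close> one, so \<open>high_prob\<close> agrees with
      \<open>p High\<close> there and monotonicity applies.\<close>
    have x_low: "x \<le> l" if "n \<le> L"
      using p_mono[of n L] n that L_le a_bounds
      by (auto simp: x_def l_def high_prob_def intro: mult_left_mono)
    have x_high: "x \<ge> h" if "n > L"
      using p_mono[of "L + 1" n] n that a_bounds
      by (auto simp: x_def h_def high_prob_def intro: mult_left_mono)
    have lim: "(\<lambda>k. high_fraction (reports k \<omega>)) \<longlonglongrightarrow> x"
    proof -
      have "high_fraction (reports k \<omega>) =
          aF + agent_fraction (T k) (\<lambda>t. contingent N \<alpha> (v k t) \<and> S k t \<omega> = High)" for k
        unfolding reports_def
        by (subst election.high_fraction_truthful[OF election truthful[OF _ \<omega>]]) (simp_all add: F)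
      moreover have "(\<lambda>k. aF + agent_fraction (T k)
          (\<lambda>t. contingent N \<alpha> (v k t) \<and> S k t \<omega> = High)) \<longlonglongrightarrow> x"
        unfolding x_def using conv n by (intro tendsto_intros) (auto simp: n_def)
      ultimately show ?thesis by simp
    qed
    have limit_decision: "majority_favors (T k) (v k) n (decide x (median_threshold (reports k \<omega>)))" for k
    proof (rule election.majority_favors_decide[OF election n])
      \<comment> \<open>Openness matters: \<open>x\<close> may equal an endpoint, namely when
        \<open>n\<close> is \<open>L\<close> or \<open>L + 1\<close>, and acceptance needs
        \<open>x\<close> strictly above the median.\<close>
      have "median_threshold (reports k \<omega>) \<in> {l<..<h}"
        unfolding reports_def
        by (rule election.median_threshold_in_interval[OF election])
          (use truthful[OF _ \<omega>] lh in \<open>auto simp: lo hi is_interval_1\<close>)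
      then show "n \<le> pivot_low N \<alpha> \<Longrightarrow> x \<le> median_threshold (reports k \<omega>)"
        and "n > pivot_low N \<alpha> \<Longrightarrow> x > median_threshold (reports k \<omega>)"
        using x_low x_high by (auto simp: L_def)
    qed
    have "\<forall>\<^sub>F k in sequentially.
        (\<forall>t<T k. truthful_report N \<alpha> {lo k + \<delta>..hi k - \<delta>} (v k t) (S k t \<omega>) (r k t \<omega>)) \<longrightarrow>
        majority_favors (T k) (v k) n (mechanism (reports k \<omega>))" if \<delta>: "\<delta> > 0" for \<delta>
    proof (rule eventually_mono[OF tendstoD[OF lim \<delta>]], intro impI)
      fix k
      assume close: "dist (high_fraction (reports k \<omega>)) x < \<delta>"
        and margin: "\<forall>t<T k. truthful_report N \<alpha> {lo k + \<delta>..hi k - \<delta>} (v k t) (S k t \<omega>) (r k t \<omega>)"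
      \<comment> \<open>The fraction is less than \<delta> away from \<open>x\<close>, so it is
        below \<open>l + \<delta>\<close> if \<open>n \<le> L\<close> and above
        \<open>h - \<delta>\<close> if \<open>n > L\<close>, on the same side of the median as in
        the limit.\<close>
      have "median_threshold (reports k \<omega>) \<in> {l + \<delta>..h - \<delta>}"
        unfolding reports_def
        by (rule election.median_threshold_in_interval[OF election])
          (use margin lh \<delta> in \<open>auto simp: lo hi is_interval_1\<close>)
      then show "majority_favors (T k) (v k) n (mechanism (reports k \<omega>))"
        unfolding mechanism_def
        using x_low x_high close
        by (intro election.majority_favors_decide[OF election n]) (auto simp: L_def dist_real_def)
    qed
    with lim limit_decision show "(\<exists>x. (\<lambda>k. high_fraction (reports k \<omega>)) \<longlonglongrightarrow> x \<and>
                (\<forall>k. majority_favors (T k) (v k) (W \<omega>)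
                        (decide x (median_threshold (reports k \<omega>))))) \<and>
           (\<forall>\<delta>>0. \<forall>\<^sub>F k in sequentially.
                (\<forall>t<T k. truthful_report N \<alpha> {lo k + \<delta>..hi k - \<delta>} (v k t) (S k t \<omega>) (r k t \<omega>)) \<longrightarrow>
                majority_favors (T k) (v k) (W \<omega>) (mechanism (reports k \<omega>)))"
      unfolding n_def[symmetric] by blast
  qed
qed

end
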